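(* Let $\mathcal{K}\subseteq[0,1]^n$ be a convex set with diameter $D$, let $\beta>0$, and let $F\colon[0,1]^n\to\mathbb{R}_{\geq0}$ be a non-negative $\beta$-smooth DR-submodular function. Let $T\geq 0$ be an integer and $\varepsilon\in(0,1)$, and let $\mathbf{w}$ be the output of the algorithm NMFW$(T,\varepsilon)$ described in the context. Then $\mathbf{w}\in\mathcal{K}$ and \[ F(\mathbf{w})\geq(1-2\varepsilon)^{T-1}\big[(1+\varepsilon)^T-1\big]\Big(1-\min_{\mathbf{x}\in\mathcal{K}}\|\mathbf{x}\|_\infty\Big)F(\mathbf{o})-0.5\varepsilon^2\beta D^2T, \] where $\mathbf{o}\in\arg\max_{\mathbf{x}\in\mathcal{K}}F(\mathbf{x})$. In particular, when $T=\lfloor \ln 2/\varepsilon\rfloor$, \[ F(\mathbf{w})\geq\Big(\tfrac14-3\varepsilon\Big)\Big(1-\min_{\mathbf{x}\in\mathcal{K}}\|\mathbf{x}\|_\infty\Big)F(\mathbf{o})-0.5\varepsilon\beta D^2. \]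
   Context: A function $F\colon[0,1]^n\to\mathbb{R}$ is DR-submodular if for all $\mathbf{a}\leq\mathbf{b}$ (coordinate-wise) in $[0,1]^n$, every $k>0$ and coordinate $i$ with $\mathbf{b}+k\mathbf{e}_i\in[0,1]^n$, we have $F(\mathbf{a}+k\mathbf{e}_i)-F(\mathbf{a})\geq F(\mathbf{b}+k\mathbf{e}_i)-F(\mathbf{b})$. $F$ is $\beta$-smooth if it is continuously differentiable and $\|\nabla F(\mathbf{x})-\nabla F(\mathbf{y})\|_2\leq\beta\|\mathbf{x}-\mathbf{y}\|_2$ for all $\mathbf{x},\mathbf{y}\in[0,1]^n$. Algorithm NMFW$(T,\varepsilon)$: set $\mathbf{y}^{(0)}\in\arg\min_{\mathbf{x}\in\mathcal{K}}\|\mathbf{x}\|_\infty$; for $i=1,\dots,T$, let $\mathbf{s}^{(i)}\in\arg\max_{\mathbf{x}\in\mathcal{K}}\langle\nabla F(\mathbf{y}^{(i-1)}),\mathbf{x}\rangle$ and $\mathbf{y}^{(i)}=(1-\varepsilon)\mathbf{y}^{(i-1)}+\varepsilon\mathbf{s}^{(i)}$; return a vector maximizing $F$ among $\mathbf{y}^{(0)},\dots,\mathbf{y}^{(T)}$.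
   Formalization: The first inequality is proved for ε ≤ 1/2 only; for larger ε it can fail (K={0}, F=1, T=3, ε=0.9 would require 1 ≥ 3.7). Membership of w in K and the final bound for T=⌊ln 2/ε⌋ are proved for all ε in (0,1). *)

theory Defs
  imports "HOL-Analysis.Analysis"
begin

definition unit_cube :: "(real ^ 'n) set" where
  "unit_cube = cbox 0 1"

text \<open>The objective is only given on the closed cube, so derivatives are taken within the cube
  (one-sided at the boundary); values of \<open>F\<close> outside the cube are irrelevant. Within the cube the
  derivative is unique wherever it exists.\<close>

definition cube_gradient :: "(real ^ 'n \<Rightarrow> real) \<Rightarrow> real ^ 'n \<Rightarrow> real ^ 'n" where
  "cube_gradient F x = (\<chi> i. frechet_derivative F (at x within unit_cube) (axis i 1))"

definition DR_submodular :: "(real ^ 'n \<Rightarrow> real) \<Rightarrow> bool" where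
  "DR_submodular F \<longleftrightarrow>
     (\<forall>a\<in>unit_cube. \<forall>b\<in>unit_cube. \<forall>k>0. \<forall>i.
        a \<le> b \<longrightarrow> b + k *\<^sub>R axis i 1 \<in> unit_cube \<longrightarrow>
        F (a + k *\<^sub>R axis i 1) - F a \<ge> F (b + k *\<^sub>R axis i 1) - F b)"

definition smooth_on_cube :: "real \<Rightarrow> (real ^ 'n \<Rightarrow> real) \<Rightarrow> bool" where
  "smooth_on_cube \<beta> F \<longleftrightarrow>
     F differentiable_on unit_cube \<and>
     continuous_on unit_cube (cube_gradient F) \<and>
     (\<forall>x\<in>unit_cube. \<forall>y\<in>unit_cube.
        norm (cube_gradient F x - cube_gradient F y) \<le> \<beta> * norm (x - y))"

text \<open>The algorithm is nondeterministic in its choice of minimizers and maximizers, so it is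
  described by the relation between the input and each vector it may return. Here \<open>y i\<close> and \<open>s i\<close>
  are the iterates; the values \<open>s 0\<close>, and \<open>y i\<close>, \<open>s i\<close> for \<open>i > T\<close>, play no role.\<close>

definition NMFW_output ::
  "(real ^ 'n) set \<Rightarrow> (real ^ 'n \<Rightarrow> real) \<Rightarrow> nat \<Rightarrow> real \<Rightarrow> real ^ 'n \<Rightarrow> bool" where
  "NMFW_output K F T \<epsilon> w \<longleftrightarrow>
     (\<exists>y s.
        is_arg_min infnorm (\<lambda>x. x \<in> K) (y 0) \<and>
        (\<forall>i\<in>{1..T}.
           is_arg_max (\<lambda>x. cube_gradient F (y (i - 1)) \<bullet> x) (\<lambda>x. x \<in> K) (s i) \<and>
           y i = (1 - \<epsilon>) *\<^sub>R y (i - 1) + \<epsilon> *\<^sub>R s i) \<and>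
        is_arg_max F (\<lambda>x. x \<in> y ` {0..T}) w)"

end

theory Submission
  imports Defs
begin

text \<open>DR-submodularity makes \<open>h \<mapsto> F(x + h u) - F(x)\<close> subadditive for every direction \<open>u\<close> of constant
  sign, so \<open>F\<close> lies below its linearization along \<open>u\<close>. Applied to both parts of
  \<open>z - x = (x \<squnion> z - x) + (x \<sqinter> z - x)\<close> this gives
  \<open>\<nabla>F(x) \<bullet> (z - x) \<ge> F(x \<squnion> z) + F(x \<sqinter> z) - 2 F(x)\<close>, while concavity along the ray from \<open>z\<close> through
  \<open>x \<squnion> z\<close> gives \<open>F(x \<squnion> z) \<ge> (1 - \<parallel>x\<parallel>\<^sub>\<infinity>) F(z)\<close>. As \<open>1 - \<parallel>y\<^sub>k\<parallel>\<^sub>\<infinity>\<close> shrinks at most by the factor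
  \<open>1 - \<epsilon>\<close> per step, smoothness yields the recurrence
  \<open>F(y\<^sub>k\<^sub>+\<^sub>1) \<ge> (1 - 2\<epsilon>) F(y\<^sub>k) + \<epsilon> (1 - \<epsilon>)\<^sup>k (1 - \<parallel>y\<^sub>0\<parallel>\<^sub>\<infinity>) F(z) - \<epsilon>\<^sup>2 \<beta> D\<^sup>2 / 2\<close>,
  whose solution is estimated by means of \<open>1 - \<epsilon> \<ge> (1 - 2\<epsilon>) (1 + \<epsilon>)\<close>.\<close>

section \<open>Differentiable functions along segments\<close>

lemma convex_add_scaleR_mem:
  assumes "convex S" "x \<in> S" "x + v \<in> S" "t \<in> {0..1}"
  shows "x + t *\<^sub>R v \<in> S"
  using convexD_alt[OF assms(1-3), of t] assms(4) by (simp add: algebra_simps)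

lemma has_real_derivative_along_segment:
  fixes f :: "'a::real_normed_vector \<Rightarrow> real"
  assumes "convex S" "x \<in> S" "x + v \<in> S" and t: "t \<in> {0..1}"
    and f: "(f has_derivative f') (at (x + t *\<^sub>R v) within S)"
  shows "((\<lambda>t. f (x + t *\<^sub>R v)) has_real_derivative f' v) (at t within {0..1})"
proof -
  have "(\<lambda>t. x + t *\<^sub>R v) ` {0..1} \<subseteq> S"
    using convex_add_scaleR_mem[OF assms(1-3)] by blast
  then have "(f has_derivative f') (at (x + t *\<^sub>R v) within (\<lambda>t. x + t *\<^sub>R v) ` {0..1})"
    by (rule has_derivative_subset[OF f])
  moreover have "((\<lambda>t. x + t *\<^sub>R v) has_derivative (\<lambda>h. h *\<^sub>R v)) (at t within {0..1})"
    by (auto intro!: derivative_eq_intros)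
  ultimately have "((\<lambda>t. f (x + t *\<^sub>R v)) has_derivative (\<lambda>h. f' (h *\<^sub>R v))) (at t within {0..1})"
    using has_derivative_in_compose by blast
  then show ?thesis
    using linear_cmul[OF has_derivative_linear[OF f]]
    by (simp add: has_field_derivative_def mult_commute_abs)
qed

lemma Lipschitz_gradient_lower_bound:
  fixes f :: "'a::real_inner \<Rightarrow> real"
  assumes "convex S" and x: "x \<in> S" and xv: "x + v \<in> S"
    and g: "\<And>z. z \<in> S \<Longrightarrow> (f has_derivative (\<lambda>h. g z \<bullet> h)) (at z within S)"
    and lip: "\<beta>-lipschitz_on S g"
  shows "f x + g x \<bullet> v - \<beta> / 2 * (norm v)\<^sup>2 \<le> f (x + v)"
proof -
  define \<psi> where "\<psi> t = f (x + t *\<^sub>R v) - t * (g x \<bullet> v) + \<beta> / 2 * t\<^sup>2 * (norm v)\<^sup>2" for t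
  define \<psi>' where "\<psi>' t = (g (x + t *\<^sub>R v) - g x) \<bullet> v + \<beta> * t * (norm v)\<^sup>2" for t
  have mem: "x + t *\<^sub>R v \<in> S" if "t \<in> {0..1}" for t
    using \<open>convex S\<close> x xv that by (rule convex_add_scaleR_mem)
  have "(\<psi> has_real_derivative \<psi>' t) (at t within {0..1})" if t: "t \<in> {0..1}" for t
    unfolding \<psi>_def \<psi>'_def
    by (rule derivative_eq_intros refl
          has_real_derivative_along_segment[OF \<open>convex S\<close> x xv t g[OF mem[OF t]]])+
       (simp add: algebra_simps inner_diff_left)
  then obtain t where t: "t \<in> {0..1}" and mvt: "\<psi> 1 - \<psi> 0 = \<psi>' t"
    using mvt_very_simple[of 0 1 \<psi> "\<lambda>t h. \<psi>' t * h"] by (auto simp: has_field_derivative_def)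
  have "\<bar>(g (x + t *\<^sub>R v) - g x) \<bullet> v\<bar> \<le> norm (g (x + t *\<^sub>R v) - g x) * norm v"
    by (rule Cauchy_Schwarz_ineq2)
  also have "\<dots> \<le> \<beta> * norm (x + t *\<^sub>R v - x) * norm v"
    by (intro mult_right_mono lipschitz_on_normD[OF lip mem[OF t] x] norm_ge_zero)
  also have "\<dots> = \<beta> * t * (norm v)\<^sup>2"
    using t by (simp add: power2_eq_square)
  finally have "0 \<le> \<psi>' t"
    by (simp add: \<psi>'_def)
  with mvt show ?thesis
    by (simp add: \<psi>_def)
qed

lemma subadditive_le_derivative:
  fixes g :: "real \<Rightarrow> real"
  assumes sub: "\<And>s t. \<lbrakk>0 \<le> s; 0 \<le> t; s + t \<le> 1\<rbrakk> \<Longrightarrow> g (s + t) \<le> g s + g t"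
    and g0: "g 0 = 0" and deriv: "(g has_real_derivative D) (at 0 within {0..1})"
  shows "g 1 \<le> D"
proof -
  have multiple: "g (real k * h) \<le> real k * g h" if "0 \<le> h" "real k * h \<le> 1" for k h
    using that(2)
  proof (induction k)
    case 0
    then show ?case by (simp add: g0)
  next
    case (Suc k)
    then have "g (real k * h + h) \<le> g (real k * h) + g h" "real k * h \<le> 1"
      using \<open>0 \<le> h\<close> by (auto intro!: sub simp: algebra_simps)
    with Suc.IH show ?case
      by (simp add: algebra_simps)
  qed
  have "((\<lambda>h. g h / h) \<longlongrightarrow> D) (at 0 within {0..1})"
    using deriv by (simp add: has_field_derivative_iff g0)
  moreover have "filterlim (\<lambda>n. 1 / real (Suc n)) (at 0 within {0..1}) sequentially"
    unfolding filterlim_at using LIMSEQ_inverse_real_of_nat by (auto simp: field_simps)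
  ultimately have "(\<lambda>n. g (1 / real (Suc n)) / (1 / real (Suc n))) \<longlonglongrightarrow> D"
    by (rule filterlim_compose)
  moreover have "g 1 \<le> g (1 / real (Suc n)) / (1 / real (Suc n))" for n
    using multiple[of "1 / real (Suc n)" "Suc n"] by (simp add: mult.commute)
  ultimately show ?thesis
    by (intro tendsto_lowerbound) auto
qed

section \<open>Scalar recurrences and estimates\<close>

lemma linear_recurrence_lower_bound:
  fixes f b :: "nat \<Rightarrow> real"
  assumes a: "0 \<le> a" "a \<le> 1" and C: "0 \<le> C" and f0: "0 \<le> f 0"
    and step: "\<And>k. k < n \<Longrightarrow> a * f k + b k - C \<le> f (Suc k)"
  shows "(\<Sum>k<n. a ^ (n - Suc k) * b k) - real n * C \<le> f n"
  using step
proof (induction n)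
  case 0
  then show ?case using f0 by simp
next
  case (Suc n)
  have "a * (real n * C) \<le> real n * C"
    using a C by (intro mult_left_le_one_le) auto
  moreover have "a * ((\<Sum>k<n. a ^ (n - Suc k) * b k) - real n * C) \<le> a * f n"
    using Suc a by (intro mult_left_mono) auto
  moreover have "(\<Sum>k<n. a ^ (n - k) * b k) = a * (\<Sum>k<n. a ^ (n - Suc k) * b k)"
    by (auto simp: sum_distrib_left Suc_diff_Suc mult.assoc simp flip: power_Suc intro!: sum.cong)
  moreover have "a * f n + b n - C \<le> f (Suc n)"
    using Suc.prems by simp
  ultimately show ?case
    by (simp add: algebra_simps)
qed

lemma geometric_recurrence_lower_bound:
  fixes f :: "nat \<Rightarrow> real"
  assumes \<epsilon>: "0 \<le> \<epsilon>" "\<epsilon> \<le> 1 / 2" and M: "0 \<le> M" and C: "0 \<le> C" and f0: "0 \<le> f 0"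
    and step: "\<And>k. k < n \<Longrightarrow> (1 - 2 * \<epsilon>) * f k + \<epsilon> * (1 - \<epsilon>) ^ k * M - C \<le> f (Suc k)"
  shows "(1 - 2 * \<epsilon>) ^ (n - 1) * ((1 + \<epsilon>) ^ n - 1) * M - real n * C \<le> f n"
proof -
  let ?a = "1 - 2 * \<epsilon>"
  have summand: "?a ^ (n - 1) * (\<epsilon> * (1 + \<epsilon>) ^ k * M) \<le> ?a ^ (n - Suc k) * (\<epsilon> * (1 - \<epsilon>) ^ k * M)"
    if "k < n" for k
  proof -
    have "?a * (1 + \<epsilon>) \<le> 1 - \<epsilon>"
      by (simp add: algebra_simps)
    then have "(?a * (1 + \<epsilon>)) ^ k \<le> (1 - \<epsilon>) ^ k"
      using \<epsilon> by (intro power_mono) auto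
    then have "?a ^ (n - Suc k) * (\<epsilon> * (?a * (1 + \<epsilon>)) ^ k * M)
        \<le> ?a ^ (n - Suc k) * (\<epsilon> * (1 - \<epsilon>) ^ k * M)"
      using \<epsilon> M by (intro mult_left_mono mult_right_mono) auto
    moreover have "?a ^ (n - 1) = ?a ^ (n - Suc k) * ?a ^ k"
      using that by (simp flip: power_add)
    ultimately show ?thesis
      by (simp add: power_mult_distrib mult_ac)
  qed
  have "?a ^ (n - 1) * ((1 + \<epsilon>) ^ n - 1) * M = (\<Sum>k<n. ?a ^ (n - 1) * (\<epsilon> * (1 + \<epsilon>) ^ k * M))"
    using power_diff_1_eq[of "1 + \<epsilon>" n] by (simp add: sum_distrib_left sum_distrib_right mult_ac)
  also have "\<dots> \<le> (\<Sum>k<n. ?a ^ (n - Suc k) * (\<epsilon> * (1 - \<epsilon>) ^ k * M))"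
    by (intro sum_mono summand) auto
  also have "\<dots> - real n * C \<le> f n"
    using \<epsilon> C f0 step by (intro linear_recurrence_lower_bound) auto
  finally show ?thesis by simp
qed

lemma one_minus_power_ge_quarter:
  fixes \<epsilon> :: real
  assumes \<epsilon>: "0 \<le> \<epsilon>" "\<epsilon> \<le> 1 / 4" and n: "real (Suc n) * \<epsilon> \<le> ln 2"
  shows "(1 - 6 * \<epsilon>) / 4 \<le> (1 - 2 * \<epsilon>) ^ n"
proof -
  have "real n * (- (2 * \<epsilon>) - 2 * (2 * \<epsilon>)\<^sup>2) \<le> real n * ln (1 - 2 * \<epsilon>)"
    using \<epsilon> by (intro mult_left_mono ln_one_minus_pos_lower_bound) auto
  moreover have "real n * \<epsilon> * (2 + 8 * \<epsilon>) \<le> (ln 2 - \<epsilon>) * (2 + 8 * \<epsilon>)"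
    using n \<epsilon> by (intro mult_right_mono) (auto simp: algebra_simps)
  moreover have "0 \<le> (1 - ln 2) * \<epsilon> + \<epsilon>\<^sup>2"
    using \<epsilon> ln_2_less_1 by simp
  ultimately have "- 2 * ln 2 - 6 * \<epsilon> \<le> real n * ln (1 - 2 * \<epsilon>)"
    by (simp add: algebra_simps power2_eq_square)
  then have "exp (- 2 * ln 2 - 6 * \<epsilon>) \<le> exp (real n * ln (1 - 2 * \<epsilon>))"
    by simp
  also have "\<dots> = (1 - 2 * \<epsilon>) ^ n"
    using \<epsilon> by (simp add: exp_of_nat_mult)
  finally have "exp (- 2 * ln 2 - 6 * \<epsilon>) \<le> (1 - 2 * \<epsilon>) ^ n" .
  moreover have "exp (- 2 * ln 2 - 6 * \<epsilon>) = exp (- 6 * \<epsilon>) / 4"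
    using exp_of_nat_mult[of 2 "ln 2 :: real"] by (simp add: exp_diff exp_minus field_simps)
  moreover have "1 - 6 * \<epsilon> \<le> exp (- 6 * \<epsilon>)"
    using exp_ge_add_one_self[of "- 6 * \<epsilon>"] by simp
  ultimately show ?thesis by simp
qed

lemma one_plus_power_ge_two:
  fixes \<epsilon> :: real
  assumes \<epsilon>: "0 \<le> \<epsilon>" "\<epsilon> \<le> 1" and n: "ln 2 - \<epsilon> \<le> real n * \<epsilon>"
  shows "2 - 4 * \<epsilon> \<le> (1 + \<epsilon>) ^ n"
proof -
  have "real n * (\<epsilon> - \<epsilon>\<^sup>2) \<le> real n * ln (1 + \<epsilon>)"
    using \<epsilon> by (intro mult_left_mono ln_one_plus_pos_lower_bound) auto
  moreover have "(ln 2 - \<epsilon>) * (1 - \<epsilon>) \<le> real n * \<epsilon> * (1 - \<epsilon>)"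
    using n \<epsilon> by (intro mult_right_mono) auto
  moreover have "0 \<le> (1 - ln 2) * \<epsilon> + \<epsilon>\<^sup>2"
    using \<epsilon> ln_2_less_1 by simp
  ultimately have "ln 2 - 2 * \<epsilon> \<le> real n * ln (1 + \<epsilon>)"
    by (simp add: algebra_simps power2_eq_square)
  then have "exp (ln 2 - 2 * \<epsilon>) \<le> exp (real n * ln (1 + \<epsilon>))"
    by simp
  also have "\<dots> = (1 + \<epsilon>) ^ n"
    using \<epsilon> by (simp add: exp_of_nat_mult)
  finally have "2 * exp (- 2 * \<epsilon>) \<le> (1 + \<epsilon>) ^ n"
    by (simp add: exp_diff exp_minus field_simps)
  moreover have "1 - 2 * \<epsilon> \<le> exp (- 2 * \<epsilon>)"
    using exp_ge_add_one_self[of "- 2 * \<epsilon>"] by simp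
  ultimately show ?thesis by simp
qed

lemma quarter_minus_three_epsilon_le:
  fixes \<epsilon> :: real
  assumes \<epsilon>: "0 < \<epsilon>" "\<epsilon> \<le> 1 / 12" and n: "int n = \<lfloor>ln 2 / \<epsilon>\<rfloor>"
  shows "1 / 4 - 3 * \<epsilon> \<le> (1 - 2 * \<epsilon>) ^ (n - 1) * ((1 + \<epsilon>) ^ n - 1)"
proof -
  have "real n \<le> ln 2 / \<epsilon>" "ln 2 / \<epsilon> - 1 \<le> real n"
    using n by linarith+
  then have n_le: "real n * \<epsilon> \<le> ln 2" and n_ge: "ln 2 - \<epsilon> \<le> real n * \<epsilon>"
    using \<epsilon> by (simp_all add: field_simps)
  have "0 < n"
    using n_ge \<epsilon> ln2_ge_two_thirds by (intro gr0I) auto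
  then have "(1 - 6 * \<epsilon>) / 4 \<le> (1 - 2 * \<epsilon>) ^ (n - 1)"
    using \<epsilon> n_le by (intro one_minus_power_ge_quarter) auto
  moreover have "1 - 4 * \<epsilon> \<le> (1 + \<epsilon>) ^ n - 1"
    using one_plus_power_ge_two[OF _ _ n_ge] \<epsilon> by simp
  ultimately have "(1 - 6 * \<epsilon>) / 4 * (1 - 4 * \<epsilon>) \<le> (1 - 2 * \<epsilon>) ^ (n - 1) * ((1 + \<epsilon>) ^ n - 1)"
    using \<epsilon> by (intro mult_mono) auto
  moreover have "1 / 4 - 3 * \<epsilon> \<le> (1 - 6 * \<epsilon>) / 4 * (1 - 4 * \<epsilon>)"
    using \<epsilon> by (simp add: field_simps)
  ultimately show ?thesis by linarith
qed

section \<open>DR-submodular functions on the unit cube\<close>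

lemma mem_unit_cube: "x \<in> unit_cube \<longleftrightarrow> 0 \<le> x \<and> x \<le> 1"
  by (simp add: unit_cube_def flip: interval_cbox_cart)

lemma unit_cube_order_convex:
  "\<lbrakk>a \<in> unit_cube; c \<in> unit_cube; a \<le> b; b \<le> c\<rbrakk> \<Longrightarrow> b \<in> unit_cube"
  unfolding mem_unit_cube by (blast intro: order_trans)

lemma convex_unit_cube: "convex unit_cube"
  by (simp add: unit_cube_def)

lemma infnorm_le_one_unit_cube:
  assumes "x \<in> unit_cube"
  shows "infnorm x \<le> 1"
  unfolding infnorm_cart using assms
  by (intro cSup_least) (auto simp: mem_unit_cube less_eq_vec_def)

lemma cube_gradient_has_derivative:
  fixes F :: "real ^ 'n \<Rightarrow> real"
  assumes "F differentiable (at x within unit_cube)"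
  shows "(F has_derivative (\<lambda>h. cube_gradient F x \<bullet> h)) (at x within unit_cube)"
proof -
  let ?D = "frechet_derivative F (at x within unit_cube)"
  have D: "(F has_derivative ?D) (at x within unit_cube)"
    using assms by (simp flip: frechet_derivative_works)
  then interpret linear ?D
    by (rule has_derivative_linear)
  have "?D = (\<lambda>h. cube_gradient F x \<bullet> h)"
  proof (rule ext)
    fix h
    have "?D h = ?D (\<Sum>i\<in>UNIV. h $ i *\<^sub>R axis i 1)"
      using basis_expansion[of h] by (simp add: scalar_mult_eq_scaleR)
    also have "\<dots> = (\<Sum>i\<in>UNIV. h $ i * ?D (axis i 1))"
      by (simp add: sum scale)
    also have "\<dots> = cube_gradient F x \<bullet> h"
      by (simp add: cube_gradient_def inner_vec_def mult.commute)
    finally show "?D h = cube_gradient F x \<bullet> h" .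
  qed
  with D show ?thesis by simp
qed

definition diminishing_increment :: "(real ^ 'n \<Rightarrow> real) \<Rightarrow> real ^ 'n \<Rightarrow> bool" where
  "diminishing_increment F u \<longleftrightarrow>
     (\<forall>a b. a \<in> unit_cube \<longrightarrow> b + u \<in> unit_cube \<longrightarrow> a \<le> b \<longrightarrow> F (b + u) - F b \<le> F (a + u) - F a)"

lemma diminishing_incrementD:
  "\<lbrakk>diminishing_increment F u; a \<in> unit_cube; b + u \<in> unit_cube; a \<le> b\<rbrakk>
    \<Longrightarrow> F (b + u) - F b \<le> F (a + u) - F a"
  by (simp add: diminishing_increment_def)

lemma diminishing_increment_add:
  fixes F :: "real ^ 'n \<Rightarrow> real"
  assumes "0 \<le> u" "0 \<le> v" and u: "diminishing_increment F u" and v: "diminishing_increment F v"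
  shows "diminishing_increment F (u + v)"
  unfolding diminishing_increment_def
proof (intro allI impI)
  fix a b :: "real ^ 'n"
  assume a: "a \<in> unit_cube" and b: "b + (u + v) \<in> unit_cube" and "a \<le> b"
  have "b + u \<le> b + (u + v)" "a \<le> a + u" and le: "a + u \<le> b + u"
    using \<open>0 \<le> u\<close> \<open>0 \<le> v\<close> \<open>a \<le> b\<close> by simp_all
  then have "a + u \<in> unit_cube" "b + u \<in> unit_cube"
    using unit_cube_order_convex[OF a b] by (meson order_trans)+
  then have "F (b + u) - F b \<le> F (a + u) - F a"
    and "F (b + u + v) - F (b + u) \<le> F (a + u + v) - F (a + u)"
    using a b \<open>a \<le> b\<close> le
    by (simp_all add: diminishing_incrementD[OF u] diminishing_incrementD[OF v] add.assoc[symmetric])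
  then show "F (b + (u + v)) - F b \<le> F (a + (u + v)) - F a"
    by (simp add: add.assoc)
qed

lemma scaleR_axis_nonneg: "0 \<le> c \<Longrightarrow> 0 \<le> c *\<^sub>R axis i (1 :: real)"
  by (simp add: less_eq_vec_def axis_def)

lemma DR_submodular_diminishing_increment_axis:
  fixes F :: "real ^ 'n \<Rightarrow> real"
  assumes DR: "DR_submodular F" and "0 \<le> c"
  shows "diminishing_increment F (c *\<^sub>R axis i 1)"
proof (cases "c = 0")
  case True
  then show ?thesis by (simp add: diminishing_increment_def)
next
  case False
  show ?thesis
    unfolding diminishing_increment_def
  proof (intro allI impI)
    fix a b :: "real ^ 'n"
    assume a: "a \<in> unit_cube" and b: "b + c *\<^sub>R axis i 1 \<in> unit_cube" and "a \<le> b"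
    have "b \<le> b + c *\<^sub>R axis i 1"
      using scaleR_axis_nonneg[OF \<open>0 \<le> c\<close>] by simp
    then have "b \<in> unit_cube"
      by (rule unit_cube_order_convex[OF a b \<open>a \<le> b\<close>])
    with a b \<open>a \<le> b\<close> False \<open>0 \<le> c\<close>
    show "F (b + c *\<^sub>R axis i 1) - F b \<le> F (a + c *\<^sub>R axis i 1) - F a"
      using DR by (simp add: DR_submodular_def)
  qed
qed

lemma DR_submodular_diminishing_increment:
  fixes F :: "real ^ 'n \<Rightarrow> real"
  assumes DR: "DR_submodular F" and "0 \<le> u"
  shows "diminishing_increment F u"
proof -
  have coord: "0 \<le> u $ i" for i
    using \<open>0 \<le> u\<close> by (simp add: less_eq_vec_def)
  have "diminishing_increment F (\<Sum>i\<in>S. u $ i *\<^sub>R axis i 1)" if "finite S" for S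
    using that
  proof (induction S rule: finite_induct)
    case empty
    show ?case by (simp add: diminishing_increment_def)
  next
    case (insert j S)
    then show ?case
      by (auto intro!: diminishing_increment_add sum_nonneg scaleR_axis_nonneg coord
          DR_submodular_diminishing_increment_axis[OF DR])
  qed
  from this[of UNIV] show ?thesis
    using basis_expansion[of u] by (simp add: scalar_mult_eq_scaleR)
qed

lemma DR_submodular_comonotone_increments:
  fixes F :: "real ^ 'n \<Rightarrow> real"
  assumes DR: "DR_submodular F" and x: "x \<in> unit_cube" "x + u + v \<in> unit_cube"
    and "0 \<le> u \<and> 0 \<le> v \<or> u \<le> 0 \<and> v \<le> 0"
  shows "F (x + u + v) + F x \<le> F (x + u) + F (x + v)"
  using assms(4)
proof (elim disjE conjE)
  assume "0 \<le> u" "0 \<le> v"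
  then show ?thesis
    using diminishing_incrementD[OF DR_submodular_diminishing_increment[OF DR \<open>0 \<le> v\<close>] x(1) x(2)]
    by simp
next
  assume "u \<le> 0" "v \<le> 0"
  then show ?thesis
    using diminishing_incrementD[OF DR_submodular_diminishing_increment[OF DR, of "- v"] x(2),
        of "x + v"] x(1)
    by (simp add: add.commute add.left_commute)
qed

lemma DR_submodular_le_linearization:
  fixes F :: "real ^ 'n \<Rightarrow> real"
  assumes DR: "DR_submodular F" and x: "x \<in> unit_cube" "x + u \<in> unit_cube" and u: "0 \<le> u \<or> u \<le> 0"
    and F': "(F has_derivative F') (at x within unit_cube)"
  shows "F (x + u) - F x \<le> F' u"
proof -
  define g where "g t = F (x + t *\<^sub>R u) - F x" for t
  have sub: "g (s + t) \<le> g s + g t" if "0 \<le> s" "0 \<le> t" "s + t \<le> 1" for s t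
  proof -
    have "x + s *\<^sub>R u + t *\<^sub>R u \<in> unit_cube"
      using convex_add_scaleR_mem[OF convex_unit_cube x, of "s + t"] that
      by (simp add: scaleR_add_left add.assoc)
    moreover have "0 \<le> s *\<^sub>R u \<and> 0 \<le> t *\<^sub>R u \<or> s *\<^sub>R u \<le> 0 \<and> t *\<^sub>R u \<le> 0"
      using u that by (auto simp: scaleR_nonneg_nonneg scaleR_nonneg_nonpos)
    ultimately show ?thesis
      using DR_submodular_comonotone_increments[OF DR x(1)]
      by (fastforce simp: g_def scaleR_add_left add.assoc)
  qed
  have deriv: "(g has_real_derivative F' u) (at 0 within {0..1})"
    unfolding g_def
    using DERIV_diff[OF has_real_derivative_along_segment[OF convex_unit_cube x, of 0 F F']
        DERIV_const[of "F x"]] F' by simp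
  have "g 1 \<le> F' u"
    by (rule subadditive_le_derivative[OF sub _ deriv]) (simp_all add: g_def)
  then show ?thesis by (simp add: g_def)
qed

lemma DR_submodular_concave_along_nonneg:
  fixes F :: "real ^ 'n \<Rightarrow> real"
  assumes DR: "DR_submodular F" and F: "F differentiable_on unit_cube"
    and x: "x \<in> unit_cube" "x + u \<in> unit_cube" and "0 \<le> u" and t: "t \<in> {0..1}"
  shows "(1 - t) * F x + t * F (x + u) \<le> F (x + t *\<^sub>R u)"
proof -
  define m where "m = x + t *\<^sub>R u"
  have m: "m \<in> unit_cube"
    unfolding m_def using convex_unit_cube x t by (rule convex_add_scaleR_mem)
  with F obtain F' where F': "(F has_derivative F') (at m within unit_cube)"
    by (auto simp: differentiable_on_def differentiable_def)
  have end_points: "m + (1 - t) *\<^sub>R u = x + u" "m + (- t) *\<^sub>R u = x"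
    by (simp_all add: m_def algebra_simps)
  have "F (x + u) - F m \<le> F' ((1 - t) *\<^sub>R u)" "F x - F m \<le> F' ((- t) *\<^sub>R u)"
    using DR_submodular_le_linearization[OF DR m _ _ F', of "(1 - t) *\<^sub>R u"]
      DR_submodular_le_linearization[OF DR m _ _ F', of "(- t) *\<^sub>R u"] x t \<open>0 \<le> u\<close>
    unfolding end_points by (auto simp: scaleR_nonneg_nonneg scaleR_nonpos_nonneg)
  then have "F (x + u) - F m \<le> (1 - t) * F' u" "F x - F m \<le> - t * F' u"
    unfolding linear_cmul[OF has_derivative_linear[OF F']] by simp_all
  then have "t * (F (x + u) - F m) + (1 - t) * (F x - F m)
      \<le> t * ((1 - t) * F' u) + (1 - t) * (- t * F' u)"
    using t by (intro add_mono mult_left_mono) auto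
  then show ?thesis
    by (simp add: m_def algebra_simps)
qed

lemma DR_submodular_gradient_ge_sup_inf:
  fixes F :: "real ^ 'n \<Rightarrow> real"
  assumes DR: "DR_submodular F" and F: "F differentiable (at x within unit_cube)"
    and x: "x \<in> unit_cube" and z: "z \<in> unit_cube"
  shows "F (sup x z) + F (inf x z) - 2 * F x \<le> cube_gradient F x \<bullet> (z - x)"
proof -
  note linearization = DR_submodular_le_linearization[OF DR x _ _ cube_gradient_has_derivative[OF F]]
  have "sup x z \<in> unit_cube" "inf x z \<in> unit_cube"
    using x z by (auto simp: mem_unit_cube le_supI1 le_infI1)
  then have "F (sup x z) - F x \<le> cube_gradient F x \<bullet> (sup x z - x)"
    "F (inf x z) - F x \<le> cube_gradient F x \<bullet> (inf x z - x)"
    using linearization[of "sup x z - x"] linearization[of "inf x z - x"] by simp_all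
  moreover have z_minus_x: "z - x = (sup x z - x) + (inf x z - x)"
    by (auto simp: vec_eq_iff sup_vec_def inf_vec_def sup_real_def inf_real_def max_def min_def)
  ultimately show ?thesis
    unfolding z_minus_x inner_add_right by linarith
qed

lemma sup_eq_add_infnorm_scaleR:
  fixes x z :: "real ^ 'n"
  assumes x: "x \<in> unit_cube" and z: "z \<in> unit_cube"
  obtains v where "0 \<le> v" "z + v \<in> unit_cube" "sup x z = z + infnorm x *\<^sub>R v"
proof
  let ?\<theta> = "infnorm x"
  let ?v = "(1 / ?\<theta>) *\<^sub>R (sup x z - z)"
  have \<theta>: "0 \<le> ?\<theta>" "?\<theta> \<le> 1"
    using infnorm_le_one_unit_cube[OF x] by (simp_all add: infnorm_pos_le)
  show "0 \<le> ?v"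
    using \<theta> by (auto intro!: scaleR_nonneg_nonneg)
  have "(z + ?v) $ i \<le> 1" for i
  proof -
    have z_i: "0 \<le> z $ i" "z $ i \<le> 1"
      using z by (auto simp: mem_unit_cube less_eq_vec_def)
    have "x $ i \<le> ?\<theta>"
      using component_le_infnorm_cart[of x i] by simp
    moreover have "?\<theta> * z $ i \<le> z $ i"
      using \<theta> z_i by (intro mult_left_le_one_le) auto
    moreover have "0 \<le> (1 - z $ i) * ?\<theta>"
      using \<theta> z_i by simp
    ultimately have "sup x z $ i - z $ i \<le> (1 - z $ i) * ?\<theta>"
      by (auto simp: sup_vec_def sup_real_def max_def algebra_simps)
    then have "?v $ i \<le> 1 - z $ i"
      using \<theta> z_i by (cases "?\<theta> = 0") (simp_all add: divide_le_eq)
    then show ?thesis by simp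
  qed
  with \<open>0 \<le> ?v\<close> z show "z + ?v \<in> unit_cube"
    by (simp add: mem_unit_cube less_eq_vec_def)
  show "sup x z = z + ?\<theta> *\<^sub>R ?v"
  proof (cases "?\<theta> = 0")
    case True
    then have "x = 0" by (simp add: infnorm_eq_0)
    then show ?thesis using True z by (simp add: mem_unit_cube sup_absorb2)
  qed simp
qed

lemma DR_submodular_sup_ge:
  fixes F :: "real ^ 'n \<Rightarrow> real"
  assumes DR: "DR_submodular F" and F: "F differentiable_on unit_cube"
    and nonneg: "\<And>x. x \<in> unit_cube \<Longrightarrow> 0 \<le> F x"
    and x: "x \<in> unit_cube" and z: "z \<in> unit_cube"
  shows "(1 - infnorm x) * F z \<le> F (sup x z)"
proof -
  obtain v where v: "0 \<le> v" "z + v \<in> unit_cube" and sup_eq: "sup x z = z + infnorm x *\<^sub>R v"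
    using sup_eq_add_infnorm_scaleR[OF x z] .
  have "(1 - infnorm x) * F z + infnorm x * F (z + v) \<le> F (sup x z)"
    unfolding sup_eq using v infnorm_le_one_unit_cube[OF x]
    by (intro DR_submodular_concave_along_nonneg[OF DR F z]) (auto simp: infnorm_pos_le)
  moreover have "0 \<le> infnorm x * F (z + v)"
    using nonneg v by (simp add: infnorm_pos_le)
  ultimately show ?thesis by linarith
qed

lemma DR_submodular_gradient_gap:
  fixes F :: "real ^ 'n \<Rightarrow> real"
  assumes DR: "DR_submodular F" and F: "F differentiable_on unit_cube"
    and nonneg: "\<And>x. x \<in> unit_cube \<Longrightarrow> 0 \<le> F x"
    and x: "x \<in> unit_cube" and z: "z \<in> unit_cube"
  shows "(1 - infnorm x) * F z - 2 * F x \<le> cube_gradient F x \<bullet> (z - x)"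
proof -
  have "F (sup x z) + F (inf x z) - 2 * F x \<le> cube_gradient F x \<bullet> (z - x)"
    using F x
    by (intro DR_submodular_gradient_ge_sup_inf[OF DR _ x z]) (simp add: differentiable_on_def)
  moreover have "(1 - infnorm x) * F z \<le> F (sup x z)"
    using DR F nonneg x z by (rule DR_submodular_sup_ge)
  moreover have "0 \<le> F (inf x z)"
    using x z by (intro nonneg) (auto simp: mem_unit_cube le_infI1)
  ultimately show ?thesis by linarith
qed

lemma smooth_on_cube_lower_bound:
  fixes F :: "real ^ 'n \<Rightarrow> real"
  assumes F: "smooth_on_cube \<beta> F" and "0 \<le> \<beta>" and x: "x \<in> unit_cube" "x + v \<in> unit_cube"
  shows "F x + cube_gradient F x \<bullet> v - \<beta> / 2 * (norm v)\<^sup>2 \<le> F (x + v)"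
proof (rule Lipschitz_gradient_lower_bound[OF convex_unit_cube x])
  show "(F has_derivative (\<lambda>h. cube_gradient F z \<bullet> h)) (at z within unit_cube)"
    if "z \<in> unit_cube" for z
    using F that by (auto simp: smooth_on_cube_def differentiable_on_def
        intro!: cube_gradient_has_derivative)
  show "\<beta>-lipschitz_on unit_cube (cube_gradient F)"
    using F \<open>0 \<le> \<beta>\<close> by (auto simp: smooth_on_cube_def dist_norm intro!: lipschitz_onI)
qed

section \<open>The Frank-Wolfe iteration\<close>

locale Frank_Wolfe_run =
  fixes K :: "(real ^ 'n) set" and F :: "real ^ 'n \<Rightarrow> real" and \<beta> \<epsilon> :: real and T :: nat
    and y s :: "nat \<Rightarrow> real ^ 'n"
  assumes K_cube: "K \<subseteq> unit_cube" and convex_K: "convex K"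
    and \<beta>_nonneg: "0 \<le> \<beta>"
    and F_nonneg: "\<And>x. x \<in> unit_cube \<Longrightarrow> 0 \<le> F x"
    and smooth: "smooth_on_cube \<beta> F"
    and DR: "DR_submodular F"
    and \<epsilon>: "0 < \<epsilon>" "\<epsilon> < 1"
    and start: "y 0 \<in> K"
    and direction: "\<And>k. k < T \<Longrightarrow>
      is_arg_max (\<lambda>x. cube_gradient F (y k) \<bullet> x) (\<lambda>x. x \<in> K) (s (Suc k))"
    and update: "\<And>k. k < T \<Longrightarrow> y (Suc k) = (1 - \<epsilon>) *\<^sub>R y k + \<epsilon> *\<^sub>R s (Suc k)"
begin

lemma direction_mem: "k < T \<Longrightarrow> s (Suc k) \<in> K"
  using direction by (simp add: is_arg_max_def)

lemma iterate_mem: "k \<le> T \<Longrightarrow> y k \<in> K"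
proof (induction k)
  case 0
  show ?case by (rule start)
next
  case (Suc k)
  then show ?case
    using \<epsilon> by (auto simp: update intro!: convexD[OF convex_K] direction_mem)
qed

lemma one_minus_infnorm_iterate_ge:
  "k \<le> T \<Longrightarrow> (1 - \<epsilon>) ^ k * (1 - infnorm (y 0)) \<le> 1 - infnorm (y k)"
proof (induction k)
  case 0
  show ?case by simp
next
  case (Suc k)
  have "infnorm (y (Suc k)) \<le> (1 - \<epsilon>) * infnorm (y k) + \<epsilon> * infnorm (s (Suc k))"
    using Suc.prems \<epsilon> infnorm_triangle[of "(1 - \<epsilon>) *\<^sub>R y k" "\<epsilon> *\<^sub>R s (Suc k)"]
    by (simp add: update infnorm_mul)
  also have "\<epsilon> * infnorm (s (Suc k)) \<le> \<epsilon> * 1"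
    using Suc.prems \<epsilon> K_cube direction_mem[of k]
    by (intro mult_left_mono infnorm_le_one_unit_cube) auto
  finally have "(1 - \<epsilon>) * (1 - infnorm (y k)) \<le> 1 - infnorm (y (Suc k))"
    by (simp add: algebra_simps)
  moreover have "(1 - \<epsilon>) * ((1 - \<epsilon>) ^ k * (1 - infnorm (y 0))) \<le> (1 - \<epsilon>) * (1 - infnorm (y k))"
    using Suc \<epsilon> by (intro mult_left_mono) auto
  ultimately show ?case
    by (simp add: mult.assoc)
qed

lemma gradient_direction_ge:
  assumes k: "k < T" and z: "z \<in> K"
  shows "(1 - \<epsilon>) ^ k * ((1 - infnorm (y 0)) * F z) - 2 * F (y k)
    \<le> cube_gradient F (y k) \<bullet> (s (Suc k) - y k)"
proof -
  have "y k \<in> unit_cube" "z \<in> unit_cube"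
    using K_cube z iterate_mem[of k] k by auto
  then have "(1 - infnorm (y k)) * F z - 2 * F (y k) \<le> cube_gradient F (y k) \<bullet> (z - y k)"
    using smooth
    by (intro DR_submodular_gradient_gap[OF DR _ F_nonneg]) (auto simp: smooth_on_cube_def)
  also have "\<dots> \<le> cube_gradient F (y k) \<bullet> (s (Suc k) - y k)"
    using direction[OF k] z by (simp add: is_arg_max_linorder inner_diff_right)
  finally show ?thesis
    using mult_right_mono[OF one_minus_infnorm_iterate_ge F_nonneg[OF \<open>z \<in> unit_cube\<close>], of k] k
    by (simp add: mult.assoc)
qed

lemma step_lower_bound:
  assumes k: "k < T" and z: "z \<in> K"
  shows "(1 - 2 * \<epsilon>) * F (y k) + \<epsilon> * (1 - \<epsilon>) ^ k * ((1 - infnorm (y 0)) * F z)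
      - \<epsilon>\<^sup>2 * \<beta> * (diameter K)\<^sup>2 / 2 \<le> F (y (Suc k))"
proof -
  define v where "v = s (Suc k) - y k"
  have y: "y k \<in> K" "y (Suc k) \<in> K" and y_Suc: "y (Suc k) = y k + \<epsilon> *\<^sub>R v"
    using k iterate_mem[of k] iterate_mem[of "Suc k"] by (auto simp: update v_def algebra_simps)
  have "bounded K"
    using bounded_subset[OF bounded_cbox] K_cube by (auto simp: unit_cube_def)
  then have "norm v \<le> diameter K"
    using diameter_bounded_bound[of K "s (Suc k)" "y k"] y direction_mem[OF k]
    by (simp add: v_def dist_norm)
  then have "\<beta> / 2 * (norm (\<epsilon> *\<^sub>R v))\<^sup>2 \<le> \<beta> / 2 * (\<epsilon> * diameter K)\<^sup>2"
    using \<beta>_nonneg \<epsilon> by (intro mult_left_mono power_mono) auto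
  moreover have "F (y k) + cube_gradient F (y k) \<bullet> (\<epsilon> *\<^sub>R v) - \<beta> / 2 * (norm (\<epsilon> *\<^sub>R v))\<^sup>2
      \<le> F (y (Suc k))"
    unfolding y_Suc using y K_cube y_Suc
    by (intro smooth_on_cube_lower_bound[OF smooth \<beta>_nonneg]) auto
  moreover have "\<epsilon> * ((1 - \<epsilon>) ^ k * ((1 - infnorm (y 0)) * F z) - 2 * F (y k))
      \<le> \<epsilon> * (cube_gradient F (y k) \<bullet> v)"
    using gradient_direction_ge[OF k z] \<epsilon> by (simp add: v_def)
  ultimately show ?thesis
    by (simp add: power_mult_distrib algebra_simps)
qed

lemma one_minus_infnorm_start_mult_nonneg:
  assumes "z \<in> K"
  shows "0 \<le> (1 - infnorm (y 0)) * F z"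
proof -
  have "infnorm (y 0) \<le> 1" "0 \<le> F z"
    using assms start K_cube by (auto intro!: infnorm_le_one_unit_cube F_nonneg)
  then show ?thesis by simp
qed

lemma last_iterate_ge:
  assumes "\<epsilon> \<le> 1 / 2" and z: "z \<in> K"
  shows "(1 - 2 * \<epsilon>) ^ (T - 1) * ((1 + \<epsilon>) ^ T - 1) * (1 - infnorm (y 0)) * F z
      - 0.5 * \<epsilon>\<^sup>2 * \<beta> * (diameter K)\<^sup>2 * real T \<le> F (y T)"
proof -
  have "0 \<le> F (y 0)"
    using F_nonneg K_cube start by blast
  then have "(1 - 2 * \<epsilon>) ^ (T - 1) * ((1 + \<epsilon>) ^ T - 1) * ((1 - infnorm (y 0)) * F z)
      - real T * (\<epsilon>\<^sup>2 * \<beta> * (diameter K)\<^sup>2 / 2) \<le> F (y T)"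
    using \<epsilon> \<beta>_nonneg \<open>\<epsilon> \<le> 1 / 2\<close>
    by (intro geometric_recurrence_lower_bound[where f = "\<lambda>k. F (y k)"]
        one_minus_infnorm_start_mult_nonneg step_lower_bound z) auto
  then show ?thesis
    by (simp add: mult_ac)
qed

lemma last_iterate_ge_quarter:
  assumes T: "int T = \<lfloor>ln 2 / \<epsilon>\<rfloor>" and z: "z \<in> K"
  shows "(1 / 4 - 3 * \<epsilon>) * (1 - infnorm (y 0)) * F z - 0.5 * \<epsilon> * \<beta> * (diameter K)\<^sup>2 \<le> F (y T)"
proof (cases "\<epsilon> \<le> 1 / 12")
  case True
  let ?c = "(1 - 2 * \<epsilon>) ^ (T - 1) * ((1 + \<epsilon>) ^ T - 1)"
  have "(1 / 4 - 3 * \<epsilon>) * ((1 - infnorm (y 0)) * F z) \<le> ?c * ((1 - infnorm (y 0)) * F z)"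
    by (rule mult_right_mono[OF quarter_minus_three_epsilon_le[OF \<epsilon>(1) True T]
          one_minus_infnorm_start_mult_nonneg[OF z]])
  then have "(1 / 4 - 3 * \<epsilon>) * (1 - infnorm (y 0)) * F z \<le> ?c * (1 - infnorm (y 0)) * F z"
    by (simp add: mult.assoc)
  moreover have "?c * (1 - infnorm (y 0)) * F z - 0.5 * \<epsilon>\<^sup>2 * \<beta> * (diameter K)\<^sup>2 * real T \<le> F (y T)"
    using True z by (intro last_iterate_ge) auto
  moreover have "0.5 * \<epsilon>\<^sup>2 * \<beta> * (diameter K)\<^sup>2 * real T \<le> 0.5 * \<epsilon> * \<beta> * (diameter K)\<^sup>2"
  proof -
    have "real T \<le> ln 2 / \<epsilon>"
      using T by linarith
    then have "real T * \<epsilon> \<le> 1"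
      using \<epsilon> ln_2_less_1 by (simp add: field_simps)
    then have "real T * \<epsilon> * (0.5 * \<epsilon> * \<beta> * (diameter K)\<^sup>2) \<le> 0.5 * \<epsilon> * \<beta> * (diameter K)\<^sup>2"
      using \<epsilon> \<beta>_nonneg by (intro mult_left_le_one_le) auto
    then show ?thesis
      by (simp add: power2_eq_square mult_ac)
  qed
  ultimately show ?thesis by linarith
next
  case False
  then have "(1 / 4 - 3 * \<epsilon>) * ((1 - infnorm (y 0)) * F z) \<le> 0"
    by (intro mult_nonpos_nonneg one_minus_infnorm_start_mult_nonneg z) auto
  moreover have "0 \<le> 0.5 * \<epsilon> * \<beta> * (diameter K)\<^sup>2"
    using \<epsilon> \<beta>_nonneg by simp
  moreover have "0 \<le> F (y T)"
    using F_nonneg K_cube iterate_mem by blast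
  ultimately show ?thesis
    unfolding mult.assoc[of _ "1 - infnorm (y 0)"] by linarith
qed

end

theorem theorem3p1:
  fixes K :: "(real ^ 'n) set" and F :: "real ^ 'n \<Rightarrow> real"
    and D \<beta> \<epsilon> :: real and T :: nat and w opt :: "real ^ 'n"
  assumes "K \<subseteq> unit_cube" and "convex K" and "D = diameter K"
    and "\<beta> > 0"
    and "\<And>x. x \<in> unit_cube \<Longrightarrow> F x \<ge> 0"
    and "smooth_on_cube \<beta> F"
    and "DR_submodular F"
    and "0 < \<epsilon>" and "\<epsilon> < 1"
    and "NMFW_output K F T \<epsilon> w"
    and "is_arg_max F (\<lambda>x. x \<in> K) opt"
  shows "w \<in> K
    \<and> (\<epsilon> \<le> 1 / 2 \<longrightarrow>
        F w \<ge> (1 - 2 * \<epsilon>) powi (int T - 1) * ((1 + \<epsilon>) ^ T - 1)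
                * (1 - (INF x\<in>K. infnorm x)) * F opt
              - 0.5 * \<epsilon>\<^sup>2 * \<beta> * D\<^sup>2 * real T)
    \<and> (int T = \<lfloor>ln 2 / \<epsilon>\<rfloor> \<longrightarrow>
        F w \<ge> (1 / 4 - 3 * \<epsilon>) * (1 - (INF x\<in>K. infnorm x)) * F opt
              - 0.5 * \<epsilon> * \<beta> * D\<^sup>2)"
proof -
  obtain y s where y0: "is_arg_min infnorm (\<lambda>x. x \<in> K) (y 0)"
    and steps: "\<forall>i\<in>{1..T}. is_arg_max (\<lambda>x. cube_gradient F (y (i - 1)) \<bullet> x) (\<lambda>x. x \<in> K) (s i) \<and>
      y i = (1 - \<epsilon>) *\<^sub>R y (i - 1) + \<epsilon> *\<^sub>R s i"
    and w: "is_arg_max F (\<lambda>x. x \<in> y ` {0..T}) w"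
    using \<open>NMFW_output K F T \<epsilon> w\<close> unfolding NMFW_output_def by blast
  interpret Frank_Wolfe_run K F \<beta> \<epsilon> T y s
    by unfold_locales (use assms y0 bspec[OF steps, of "Suc _"] in \<open>auto simp: is_arg_min_def\<close>)
  have "w \<in> K" "opt \<in> K" and best: "F (y T) \<le> F w"
    using w assms(11) iterate_mem by (auto simp: is_arg_max_linorder)
  have min_infnorm: "(INF x\<in>K. infnorm x) = infnorm (y 0)"
    using y0 by (intro cInf_eq_minimum) (auto simp: is_arg_min_linorder)
  have powi_eq: "(1 - 2 * \<epsilon>) powi (int T - 1) * ((1 + \<epsilon>) ^ T - 1)
      = (1 - 2 * \<epsilon>) ^ (T - 1) * ((1 + \<epsilon>) ^ T - 1)"
    by (cases T) simp_all
  show ?thesis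
    unfolding min_infnorm powi_eq \<open>D = diameter K\<close>
    using \<open>w \<in> K\<close> order_trans[OF last_iterate_ge[OF _ \<open>opt \<in> K\<close>] best]
      order_trans[OF last_iterate_ge_quarter[OF _ \<open>opt \<in> K\<close>] best] by blast
qed

end
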